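(* As formal power series in $x$ and $y$, $$\sum_{n\geq 1}\sum_{k=0}^{\lfloor (n-1)/2\rfloor} Q(n-1,k)\,x^ny^k=\sum_{n\geq 1} \frac{x^n}{\prod_{k=1}^n(1-kx^2y)},$$ where $Q(m,k)$ is the number of partial matchings of $[m]$ with exactly $k$ arcs, no neighbor alignments and no left nestings.
   Context: Write $[m]=\{1,2,\ldots,m\}$, with $[0]=\emptyset$; the empty set has exactly one partial matching (the empty one, with $0$ arcs), so $Q(0,0)=1$. A partition $\pi$ of $[m]$ (set partition into nonempty blocks) is represented by a diagram with vertices $1,\ldots,m$: for each block $B=\{i_1<i_2<\cdots<i_r\}$ one draws the arcs $(i_1,i_2),(i_2,i_3),\ldots,(i_{r-1},i_r)$. A partial matching of $[m]$ is a partition of $[m]$ in which each block has at most two elements; its arcs are the pairs $(i,j)$, $i<j$, such that $\{i,j\}$ is a block. A neighbor alignment is a pair of arcs $(i_1,j_1),(i_2,j_2)$ with $i_1<j_1<i_2<j_2$ and $j_1+1=i_2$. A left nesting is a pair of arcs $(i_1,j_1),(i_2,j_2)$ with $i_1<i_2<j_2<j_1$ and $i_1+1=i_2$. *)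

theory Defs
  imports
    "HOL-Library.Disjoint_Sets"
    "HOL-Computational_Algebra.Formal_Power_Series"
begin

definition partial_matching :: "nat \<Rightarrow> nat set set \<Rightarrow> bool" where
  "partial_matching m P \<longleftrightarrow> partition_on {1..m} P \<and> (\<forall>B\<in>P. card B \<le> 2)"

definition arcs :: "nat set set \<Rightarrow> (nat \<times> nat) set" where
  "arcs P = {(i, j). i < j \<and> {i, j} \<in> P}"

definition neighbor_alignment :: "nat \<times> nat \<Rightarrow> nat \<times> nat \<Rightarrow> bool" where
  "neighbor_alignment = (\<lambda>(i1, j1) (i2, j2). i1 < j1 \<and> j1 < i2 \<and> i2 < j2 \<and> j1 + 1 = i2)"

definition left_nesting :: "nat \<times> nat \<Rightarrow> nat \<times> nat \<Rightarrow> bool" where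
  "left_nesting = (\<lambda>(i1, j1) (i2, j2). i1 < i2 \<and> i2 < j2 \<and> j2 < j1 \<and> i1 + 1 = i2)"

definition Q :: "nat \<Rightarrow> nat \<Rightarrow> nat" where
  "Q m k = card {P. partial_matching m P \<and> card (arcs P) = k \<and>
     \<not> (\<exists>a\<in>arcs P. \<exists>b\<in>arcs P. neighbor_alignment a b) \<and>
     \<not> (\<exists>a\<in>arcs P. \<exists>b\<in>arcs P. left_nesting a b)}"

text \<open>
  Power series in two variables are represented as power series in \<open>X\<close> whose coefficients
  are power series in \<open>Y\<close>. The topology on \<^typ>\<open>rat fps fps\<close> underlying \<^const>\<open>summable\<close> and
  \<^const>\<open>suminf\<close> is then the \<open>X\<close>-adic one, with discrete coefficients; convergence in it
  implies coefficientwise convergence in both variables. The coefficients are rational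
  only because the library defines division of power series over types with an inverse.
\<close>

abbreviation X :: "rat fps fps" where
  "X \<equiv> fps_X"

abbreviation Y :: "rat fps fps" where
  "Y \<equiv> fps_const fps_X"

end

(*
  Delete the last vertex of an avoiding matching of [m + 2]. If it is isolated, an avoiding
  matching of [m + 1] remains. Otherwise it closes an arc (i, m + 2), and deleting that arc leaves
  an avoiding matching E of [m]. Conversely, the opener i may be inserted exactly where it is not
  immediately followed by an opener (left nesting with the new outermost closer) nor immediately
  preceded by a closer (neighbor alignment). Since no closer of E is immediately followed by an
  opener, the two kinds of forbidden positions are disjoint, and m + 1 - 2 k of the m + 1 positions
  are allowed. The resulting recurrence
    Q (m + 2) (k + 1) = Q (m + 1) (k + 1) + (m + 1 - 2 k) Q m k
  is the one satisfied by the coefficients of the right-hand side, whose n-th summand contributes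
  to x^N y^k only for N = n + 2 k.
*)
theory Submission
  imports Defs
begin

section \<open>Partial matchings encoded by their arcs\<close>

text \<open>Isolated vertices stay implicit, so that inserting or deleting an arc is a plain set
  operation. The second conjunct says that no vertex lies on two arcs.\<close>

definition arc_set :: "nat \<Rightarrow> (nat \<times> nat) set \<Rightarrow> bool" where
  "arc_set m E \<longleftrightarrow> (\<forall>i j. (i, j) \<in> E \<longrightarrow> 1 \<le> i \<and> i < j \<and> j \<le> m) \<and>
     (\<forall>i j i' j'. (i, j) \<in> E \<longrightarrow> (i', j') \<in> E \<longrightarrow> i \<noteq> j' \<and> (i = i' \<longleftrightarrow> j = j'))"

text \<open>Both forbidden patterns, stripped of the inequalities that \<open>arc_set\<close>
  already guarantees.\<close>

definition avoiding :: "(nat \<times> nat) set \<Rightarrow> bool" where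
  "avoiding E \<longleftrightarrow> (\<forall>i j i' j'. (i, j) \<in> E \<longrightarrow> (i', j') \<in> E \<longrightarrow>
     i' \<noteq> Suc j \<and> (i' = Suc i \<longrightarrow> j < j'))"

definition avoiding_arc_sets :: "nat \<Rightarrow> nat \<Rightarrow> (nat \<times> nat) set set" where
  "avoiding_arc_sets m k = {E. arc_set m E \<and> card E = k \<and> avoiding E}"

lemma arc_set_subset: "arc_set m E \<Longrightarrow> E \<subseteq> {1..m} \<times> {1..m}"
  by (auto simp: arc_set_def) force+

lemma finite_arc_set: "arc_set m E \<Longrightarrow> finite E"
  using arc_set_subset finite_subset by blast

lemma finite_avoiding_arc_sets: "finite (avoiding_arc_sets m k)"
  by (rule finite_subset[of _ "Pow ({1..m} \<times> {1..m})"])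
    (auto simp: avoiding_arc_sets_def dest!: arc_set_subset)

lemma inj_on_fst_arc_set: "arc_set m E \<Longrightarrow> inj_on fst E"
  by (auto simp: arc_set_def inj_on_def)

lemma inj_on_snd_arc_set: "arc_set m E \<Longrightarrow> inj_on snd E"
  by (auto simp: arc_set_def inj_on_def)

lemma card_endpoints:
  assumes "arc_set m E"
  shows "card (fst ` E) = card E" "card (snd ` E) = card E"
  using assms by (simp_all add: card_image inj_on_fst_arc_set inj_on_snd_arc_set)

text \<open>Openers and closers form disjoint subsets of \<open>{1..m}\<close>, each of size
  \<open>card E\<close>.\<close>

lemma card_arc_set_le:
  assumes "arc_set m E"
  shows "2 * card E \<le> m"
proof -
  have "card (fst ` E \<union> snd ` E) = card (fst ` E) + card (snd ` E)"
    using assms finite_arc_set[OF assms]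
    by (intro card_Un_disjoint) (auto simp: arc_set_def)
  moreover have "card (fst ` E \<union> snd ` E) \<le> card {1..m}"
    using arc_set_subset[OF assms] by (intro card_mono) auto
  ultimately show ?thesis
    using card_endpoints[OF assms] by simp
qed

section \<open>Inserting an arc that closes at the last vertex\<close>

text \<open>The order-preserving relabelling that makes room for a new vertex at
  \<open>i\<close>.\<close>

definition skip :: "nat \<Rightarrow> nat \<Rightarrow> nat" where
  "skip i v = (if v < i then v else Suc v)"

lemma inj_skip: "inj (skip i)"
  by (auto simp: inj_def skip_def split: if_splits)

lemma skip_less_iff: "skip i a < skip i b \<longleftrightarrow> a < b"
  and skip_eq_iff: "skip i a = skip i b \<longleftrightarrow> a = b"
  and skip_neq: "skip i a \<noteq> i" "i \<noteq> skip i a"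
  by (auto simp: skip_def)

lemma skip_surj: "b \<noteq> i \<Longrightarrow> \<exists>a. b = skip i a"
  by (rule exI[of _ "if b < i then b else b - 1"]) (auto simp: skip_def)

text \<open>In use, \<open>n\<close> is \<open>m + 2\<close>: two vertices are added to
  \<open>[m]\<close>, the opener \<open>i\<close> and the new last vertex.\<close>

definition insert_arc :: "nat \<Rightarrow> nat \<Rightarrow> (nat \<times> nat) set \<Rightarrow> (nat \<times> nat) set" where
  "insert_arc n i E = insert (i, n) (map_prod (skip i) (skip i) ` E)"

text \<open>Openers are excluded because \<^const>\<open>skip\<close> moves an opener at \<open>i\<close> to \<open>Suc i\<close>, where it
  would form a left nesting with the inserted arc.\<close>

definition insertion_points :: "nat \<Rightarrow> (nat \<times> nat) set \<Rightarrow> nat set" where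
  "insertion_points m E = {1..Suc m} - fst ` E - Suc ` snd ` E"

lemma card_insertion_points:
  assumes E: "arc_set m E" "avoiding E"
  shows "card (insertion_points m E) = m + 1 - 2 * card E"
proof -
  \<comment> \<open>Disjointness is exactly the absence of neighbor alignments.\<close>
  have "card (fst ` E \<union> Suc ` snd ` E) = card (fst ` E) + card (Suc ` snd ` E)"
    using E finite_arc_set[OF E(1)]
    by (intro card_Un_disjoint) (auto simp: avoiding_def)
  moreover have "card (Suc ` snd ` E) = card (snd ` E)"
    by (simp add: card_image)
  moreover have "fst ` E \<union> Suc ` snd ` E \<subseteq> {1..Suc m}"
    using arc_set_subset[OF E(1)] by auto
  moreover have "insertion_points m E = {1..Suc m} - (fst ` E \<union> Suc ` snd ` E)"
    by (auto simp: insertion_points_def)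
  ultimately show ?thesis
    using card_endpoints[OF E(1)] finite_arc_set[OF E(1)]
    by (simp add: card_Diff_subset)
qed

lemma mem_insert_arc:
  "(a, b) \<in> insert_arc n i E \<longleftrightarrow>
     a = i \<and> b = n \<or> (\<exists>a' b'. (a', b') \<in> E \<and> a = skip i a' \<and> b = skip i b')"
  by (auto simp: insert_arc_def)

lemma arc_set_insert_arc:
  assumes "arc_set m E" "i \<in> {1..Suc m}"
  shows "arc_set (m + 2) (insert_arc (m + 2) i E)"
proof -
  have le: "1 \<le> a \<and> a < b \<and> b \<le> m" if "(a, b) \<in> E" for a b
    using assms(1) that by (simp add: arc_set_def)
  have s: "1 \<le> skip i a" "skip i a \<noteq> m + 2" "skip i b < m + 2" if "(a, b) \<in> E" for a b
    using le[OF that] by (auto simp: skip_def)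
  show ?thesis
    unfolding arc_set_def
  proof (intro conjI allI impI)
    fix a b assume "(a, b) \<in> insert_arc (m + 2) i E"
    then consider "a = i" "b = m + 2"
      | a' b' where "(a', b') \<in> E" "a = skip i a'" "b = skip i b'"
      unfolding mem_insert_arc by blast
    then show "1 \<le> a" "a < b" "b \<le> m + 2"
      using assms(2) le s by (cases; fastforce simp: skip_less_iff)+
  next
    fix a b a' b'
    assume ab: "(a, b) \<in> insert_arc (m + 2) i E" "(a', b') \<in> insert_arc (m + 2) i E"
    have E: "x \<noteq> y' \<and> (x = x' \<longleftrightarrow> y = y')" if "(x, y) \<in> E" "(x', y') \<in> E" for x y x' y'
      using assms(1) that by (simp add: arc_set_def)
    have i: "i \<noteq> m + 2"
      using assms(2) by simp
    from ab show "a \<noteq> b'" "a = a' \<longleftrightarrow> b = b'"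
      unfolding mem_insert_arc
      by (elim disjE exE conjE; use E s i in \<open>force simp: skip_eq_iff skip_neq\<close>)+
  qed
qed

text \<open>Vertices that are adjacent after \<open>skip\<close> were adjacent before, so two old
  arcs form no new pattern. The new arc has the largest closer, so it can only be the outer arc of a
  nesting or the right arc of an alignment; the choice of \<open>i\<close> excludes both.\<close>

lemma avoiding_insert_arc:
  assumes "arc_set m E" "avoiding E" "i \<in> insertion_points m E"
  shows "avoiding (insert_arc (m + 2) i E)"
  unfolding avoiding_def
proof (intro conjI allI impI)
  fix a b a' b'
  assume *: "(a, b) \<in> insert_arc (m + 2) i E" "(a', b') \<in> insert_arc (m + 2) i E"
  have V: "1 \<le> i" "i \<le> Suc m" "(i, x) \<notin> E" "(x, y) \<in> E \<Longrightarrow> i \<noteq> Suc y" for x y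
    using assms(3) by (force simp: insertion_points_def)+
  have le: "1 \<le> x \<and> x < y \<and> y \<le> m" if "(x, y) \<in> E" for x y
    using assms(1) that by (auto simp: arc_set_def)
  have av: "x' \<noteq> Suc y" "x' = Suc x \<Longrightarrow> y < y'" if "(x, y) \<in> E" "(x', y') \<in> E" for x y x' y'
    using assms(2) that by (auto simp: avoiding_def)
  show "a' \<noteq> Suc b"
    using * V le av(1) by (fastforce simp: mem_insert_arc skip_def split: if_splits)
  show "b < b'" if "a' = Suc a"
    using * that V le av(2) unfolding mem_insert_arc
    by (elim disjE exE conjE; fastforce simp: skip_def split: if_splits)
qed

text \<open>Shifted closers are at most \<open>m + 1\<close>, so \<open>i\<close> is recovered as
  the opener of the arc closing at \<open>m + 2\<close>; injectivity of \<open>skip\<close> then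
  recovers \<open>E\<close>.\<close>

lemma insert_arc_inj:
  assumes "arc_set m E" "arc_set m E'" "insert_arc (m + 2) i E = insert_arc (m + 2) i' E'"
  shows "i = i' \<and> E = E'"
proof -
  have s: "skip j b \<noteq> m + 2" if "(a, b) \<in> E'" for a b j
  proof -
    have "b \<le> m"
      using assms(2) that by (simp add: arc_set_def)
    then show ?thesis
      by (simp add: skip_def)
  qed
  have "(i, m + 2) \<in> insert_arc (m + 2) i E"
    by (simp add: insert_arc_def)
  then have "(i, m + 2) \<in> insert_arc (m + 2) i' E'"
    unfolding assms(3) .
  then have i: "i = i'"
    unfolding mem_insert_arc using s by metis
  have "insert_arc (m + 2) i E - {(i, m + 2)} = map_prod (skip i) (skip i) ` E"
    "insert_arc (m + 2) i E' - {(i, m + 2)} = map_prod (skip i) (skip i) ` E'"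
    using skip_neq by (auto simp: insert_arc_def)
  then have "map_prod (skip i) (skip i) ` E = map_prod (skip i) (skip i) ` E'"
    using assms(3) i by metis
  then show ?thesis
    using i by (simp add: inj_image_eq_iff prod.inj_map inj_skip)
qed

lemma insert_arc_surj:
  assumes F: "arc_set (m + 2) F" "avoiding F" "(i, m + 2) \<in> F"
  obtains E where "arc_set m E" "avoiding E" "i \<in> insertion_points m E" "F = insert_arc (m + 2) i E"
proof
  \<comment> \<open>The remaining arcs, with the gap at \<open>i\<close> closed up.\<close>
  define E where "E = {(a, b). (skip i a, skip i b) \<in> F - {(i, m + 2)}}"
  have i: "1 \<le> i" "i \<le> m + 1"
    using F by (fastforce simp: arc_set_def)+
  \<comment> \<open>Every other arc misses both ends of the deleted one. Its closer is not just
    before \<open>i\<close> (alignment), and its opener is not just after \<open>i\<close>, since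
    its closer would have to exceed \<open>m + 2\<close> (nesting).\<close>
  have F': "a \<noteq> i \<and> b \<noteq> i \<and> b \<noteq> m + 2 \<and> a \<noteq> m + 2 \<and> 1 \<le> a \<and> a < b \<and> b \<le> m + 2 \<and>
      i \<noteq> Suc b \<and> a \<noteq> Suc i"
    if ab: "(a, b) \<in> F - {(i, m + 2)}" for a b
  proof -
    have "1 \<le> a \<and> a < b \<and> b \<le> m + 2" "a \<noteq> m + 2" "b \<noteq> i" "a = i \<longleftrightarrow> b = m + 2"
      using F(1,3) ab unfolding arc_set_def by blast+
    moreover from this have "a \<noteq> i"
      using ab by blast
    moreover have "i \<noteq> Suc b" "a = Suc i \<Longrightarrow> m + 2 < b"
      using F(2,3) ab unfolding avoiding_def by blast+
    ultimately show ?thesis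
      by auto
  qed
  show eq: "F = insert_arc (m + 2) i E"
  proof (rule set_eqI)
    fix p :: "nat \<times> nat"
    obtain a b where p: "p = (a, b)" by force
    show "p \<in> F \<longleftrightarrow> p \<in> insert_arc (m + 2) i E"
      unfolding p mem_insert_arc using F(3) F'[of a b] skip_surj[of a i] skip_surj[of b i]
      by (auto simp: E_def skip_neq)
  qed
  have E: "(skip i a, skip i b) \<in> F - {(i, m + 2)}" if "(a, b) \<in> E" for a b
    using that by (simp add: E_def)
  show "arc_set m E"
    unfolding arc_set_def
  proof (intro conjI allI impI)
    fix a b assume "(a, b) \<in> E"
    from F'[OF E[OF this]] i show "1 \<le> a" "a < b" "b \<le> m"
      by (auto simp: skip_def split: if_splits)
  next
    fix a b a' b' assume "(a, b) \<in> E" "(a', b') \<in> E"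
    from this[THEN E] F(1) show "a \<noteq> b'" "a = a' \<longleftrightarrow> b = b'"
      unfolding arc_set_def by (metis DiffD1 skip_eq_iff)+
  qed
  show "i \<in> insertion_points m E"
    using i F'[OF E] by (fastforce simp: insertion_points_def skip_def)
  show "avoiding E"
    unfolding avoiding_def
  proof (intro conjI allI impI)
    fix a b a' b' assume ab: "(a, b) \<in> E" "(a', b') \<in> E"
    note * = ab[THEN E]
    have av: "skip i a' \<noteq> Suc (skip i b)" "skip i a' = Suc (skip i a) \<Longrightarrow> skip i b < skip i b'"
      using * F(2) unfolding avoiding_def by blast+
    \<comment> \<open>Closing the gap makes only \<open>i - 1\<close> and \<open>i\<close> newly
      adjacent. As \<open>i\<close> is no opener of \<open>E\<close>, every adjacency relevant to
      \<open>avoiding\<close> was already present in \<open>F\<close>.\<close>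
    have "a' \<noteq> i"
      using \<open>i \<in> insertion_points m E\<close> ab by (force simp: insertion_points_def)
    then have Suc: "skip i a' = Suc (skip i x)" if "a' = Suc x" for x
      using that by (auto simp: skip_def)
    show "a' \<noteq> Suc b"
      using av(1) Suc by blast
    show "b < b'" if "a' = Suc a"
      using av(2) Suc[OF that] by (simp add: skip_less_iff)
  qed
qed

lemma card_insert_arc:
  assumes "arc_set m E"
  shows "card (insert_arc (m + 2) i E) = Suc (card E)"
proof -
  have "(i, m + 2) \<notin> map_prod (skip i) (skip i) ` E"
    using skip_neq by auto
  then show ?thesis
    using finite_arc_set[OF assms]
    by (simp add: insert_arc_def card_image inj_on_subset[OF prod.inj_map[OF inj_skip inj_skip]])
qed

section \<open>The recurrence for avoiding arc sets\<close>

lemma bij_betw_insert_arc: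
  "bij_betw (\<lambda>(E, i). insert_arc (m + 2) i E)
     (SIGMA E:avoiding_arc_sets m k. insertion_points m E)
     {F \<in> avoiding_arc_sets (m + 2) (Suc k). m + 2 \<in> snd ` F}"
  unfolding bij_betw_def
proof
  show "inj_on (\<lambda>(E, i). insert_arc (m + 2) i E)
     (SIGMA E:avoiding_arc_sets m k. insertion_points m E)"
    using insert_arc_inj by (fastforce simp: inj_on_def avoiding_arc_sets_def)
  show "(\<lambda>(E, i). insert_arc (m + 2) i E) `
     (SIGMA E:avoiding_arc_sets m k. insertion_points m E) =
     {F \<in> avoiding_arc_sets (m + 2) (Suc k). m + 2 \<in> snd ` F}" (is "?f ` ?A = ?B")
  proof
    show "?f ` ?A \<subseteq> ?B"
    proof clarify
      fix E i assume E: "E \<in> avoiding_arc_sets m k" and i: "i \<in> insertion_points m E"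
      then have i': "i \<in> {1..Suc m}" by (simp add: insertion_points_def)
      have "(i, m + 2) \<in> insert_arc (m + 2) i E" by (simp add: insert_arc_def)
      then have "m + 2 \<in> snd ` insert_arc (m + 2) i E" by force
      then show "insert_arc (m + 2) i E \<in> avoiding_arc_sets (m + 2) (Suc k) \<and>
          m + 2 \<in> snd ` insert_arc (m + 2) i E"
        using E i i' arc_set_insert_arc avoiding_insert_arc card_insert_arc
        unfolding avoiding_arc_sets_def by blast
    qed
    show "?B \<subseteq> ?f ` ?A"
    proof
      fix F assume F: "F \<in> ?B"
      then obtain i where "(i, m + 2) \<in> F" by auto
      with F obtain E where E: "arc_set m E" "avoiding E" "i \<in> insertion_points m E"
          "F = insert_arc (m + 2) i E"
        using insert_arc_surj unfolding avoiding_arc_sets_def by blast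
      moreover have "card E = k"
        using F E(4) card_insert_arc[OF E(1)] by (simp add: avoiding_arc_sets_def)
      ultimately show "F \<in> ?f ` ?A"
        by (force simp: avoiding_arc_sets_def)
    qed
  qed
qed

text \<open>Testing closers is enough: the last vertex is never an opener, as its closer would lie
  beyond it.\<close>

lemma avoiding_arc_sets_last_isolated:
  "{F \<in> avoiding_arc_sets (Suc m) k. Suc m \<notin> snd ` F} = avoiding_arc_sets m k"
proof -
  have "arc_set (Suc m) F \<and> Suc m \<notin> snd ` F \<longleftrightarrow> arc_set m F" for F
    unfolding arc_set_def by (force simp: le_Suc_eq)
  then show ?thesis
    by (auto simp: avoiding_arc_sets_def)
qed

text \<open>Truncation in \<open>m + 1 - 2 * k\<close> is harmless: if it occurs, then
  \<open>m < 2 * k\<close> and there are no arc sets to extend.\<close>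

lemma card_avoiding_arc_sets_rec:
  "card (avoiding_arc_sets (m + 2) (Suc k)) =
     card (avoiding_arc_sets (Suc m) (Suc k)) + (m + 1 - 2 * k) * card (avoiding_arc_sets m k)"
proof -
  let ?A = "avoiding_arc_sets (m + 2) (Suc k)"
  have "card ?A = card {F \<in> ?A. m + 2 \<notin> snd ` F} + card {F \<in> ?A. m + 2 \<in> snd ` F}"
    using finite_avoiding_arc_sets[of "m + 2" "Suc k"]
    by (subst card_Un_disjoint[symmetric]) (auto intro!: arg_cong[where f = card])
  moreover have "{F \<in> ?A. m + 2 \<notin> snd ` F} = avoiding_arc_sets (Suc m) (Suc k)"
    using avoiding_arc_sets_last_isolated[of "Suc m"] by simp
  moreover have "card {F \<in> ?A. m + 2 \<in> snd ` F} =
      card (SIGMA E:avoiding_arc_sets m k. insertion_points m E)"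
    using bij_betw_same_card[OF bij_betw_insert_arc] by simp
  moreover have "\<dots> = (\<Sum>E\<in>avoiding_arc_sets m k. card (insertion_points m E))"
    by (simp add: finite_avoiding_arc_sets insertion_points_def)
  moreover have "\<dots> = (\<Sum>E\<in>avoiding_arc_sets m k. m + 1 - 2 * k)"
    by (rule sum.cong) (auto simp: avoiding_arc_sets_def card_insertion_points)
  ultimately show ?thesis
    by simp
qed

lemma avoiding_arc_sets_0: "avoiding_arc_sets m 0 = {{}}"
  by (auto simp: avoiding_arc_sets_def finite_arc_set card_eq_0_iff)
    (auto simp: arc_set_def avoiding_def)

lemma avoiding_arc_sets_empty: "m < 2 * k \<Longrightarrow> avoiding_arc_sets m k = {}"
  using card_arc_set_le by (force simp: avoiding_arc_sets_def)

section \<open>Correspondence between partial matchings and arc sets\<close>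

text \<open>The inverse of \<open>arcs\<close>: vertices on no arc become singleton blocks.\<close>

definition matching_of :: "nat \<Rightarrow> (nat \<times> nat) set \<Rightarrow> nat set set" where
  "matching_of m E = (\<lambda>(i, j). {i, j}) ` E \<union> (\<lambda>v. {v}) ` ({1..m} - fst ` E - snd ` E)"

lemma mem_matching_of:
  "B \<in> matching_of m E \<longleftrightarrow> (\<exists>i j. (i, j) \<in> E \<and> B = {i, j}) \<or>
     (\<exists>v. v \<in> {1..m} \<and> v \<notin> fst ` E \<and> v \<notin> snd ` E \<and> B = {v})"
  by (auto simp: matching_of_def)

lemma partial_matching_block_cases:
  assumes "partial_matching m P" "B \<in> P"
  obtains v where "B = {v}" "v \<in> {1..m}" | i j where "B = {i, j}" "1 \<le> i" "i < j" "j \<le> m"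
proof -
  have P: "B \<subseteq> {1..m}" "B \<noteq> {}" "card B \<le> 2"
    using assms by (auto simp: partial_matching_def partition_on_def)
  then have "card B \<noteq> 0"
    using finite_subset[OF P(1)] by simp
  then have "card B = 1 \<or> card B = 2"
    using P(3) by linarith
  then show ?thesis
  proof
    assume "card B = 1"
    then show ?thesis
      using that(1) P(1) by (auto simp: card_1_singleton_iff)
  next
    assume "card B = 2"
    then obtain i j where "B = {i, j}" "i \<noteq> j"
      by (auto simp: card_2_iff)
    then show ?thesis
      using that(2)[of i j] that(2)[of j i] P(1) by (cases i j rule: linorder_cases) auto
  qed
qed

lemma partial_matching_block_unique:
  "partial_matching m P \<Longrightarrow> A \<in> P \<Longrightarrow> B \<in> P \<Longrightarrow> v \<in> A \<Longrightarrow> v \<in> B \<Longrightarrow> A = B"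
  by (auto simp: partial_matching_def partition_on_def disjoint_def)

lemma arc_set_arcs:
  assumes "partial_matching m P"
  shows "arc_set m (arcs P)"
  unfolding arc_set_def
proof (intro conjI allI impI)
  fix i j assume "(i, j) \<in> arcs P"
  then have "i < j" "{i, j} \<subseteq> {1..m}"
    using assms by (auto simp: arcs_def partial_matching_def partition_on_def)
  then show "1 \<le> i" "i < j" "j \<le> m"
    by auto
next
  fix i j i' j' assume *: "(i, j) \<in> arcs P" "(i', j') \<in> arcs P"
  \<comment> \<open>Distinct blocks are disjoint, so arcs sharing a vertex come from one block, and
    \<open>i < j\<close> fixes their orientation.\<close>
  then have "{i, j} = {i', j'}" if "{i, j} \<inter> {i', j'} \<noteq> {}"
    using that partial_matching_block_unique[OF assms, of "{i, j}" "{i', j'}"]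
    by (auto simp: arcs_def)
  then show "i \<noteq> j'" "i = i' \<longleftrightarrow> j = j'"
    using * by (auto simp: arcs_def doubleton_eq_iff)
qed

lemma matching_of_arcs:
  assumes P: "partial_matching m P"
  shows "matching_of m (arcs P) = P"
proof
  show "matching_of m (arcs P) \<subseteq> P"
  proof
    fix B assume "B \<in> matching_of m (arcs P)"
    then consider i j where "B = {i, j}" "(i, j) \<in> arcs P"
      | v where "B = {v}" "v \<in> {1..m}" "v \<notin> fst ` arcs P" "v \<notin> snd ` arcs P"
      unfolding mem_matching_of by blast
    then show "B \<in> P"
    proof cases
      case 1
      then show ?thesis by (simp add: arcs_def)
    next
      case (2 v)
      then have "v \<in> \<Union> P"
        using P by (simp add: partial_matching_def partition_on_def)
      then obtain A where A: "A \<in> P" "v \<in> A"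
        by blast
      \<comment> \<open>A two-element block containing \<open>v\<close> would give an arc at
        \<open>v\<close>, so the block is \<open>{v}\<close>.\<close>
      from P A(1) show ?thesis
      proof (cases rule: partial_matching_block_cases)
        case (2 i j)
        then have "(i, j) \<in> arcs P"
          using A by (simp add: arcs_def)
        with \<open>v \<notin> fst ` arcs P\<close> \<open>v \<notin> snd ` arcs P\<close> A 2 show ?thesis
          by force
      qed (use \<open>B = {v}\<close> A in auto)
    qed
  qed
  show "P \<subseteq> matching_of m (arcs P)"
  proof
    fix B assume B: "B \<in> P"
    from P B show "B \<in> matching_of m (arcs P)"
    proof (cases rule: partial_matching_block_cases)
      case (1 v)
      have "A = {v}" if "A \<in> P" "v \<in> A" for A
        using partial_matching_block_unique[OF P B that(1), of v] 1 that by simp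
      then have "v \<notin> fst ` arcs P" "v \<notin> snd ` arcs P"
        by (force simp: arcs_def)+
      then show ?thesis
        using 1 by (simp add: matching_of_def)
    next
      case (2 i j)
      then have "(i, j) \<in> arcs P"
        using B by (simp add: arcs_def)
      then show ?thesis
        using 2 by (force simp: matching_of_def)
    qed
  qed
qed

lemma partial_matching_matching_of:
  assumes "arc_set m E"
  shows "partial_matching m (matching_of m E)"
proof -
  have "card B \<le> 2" if "B \<in> matching_of m E" for B
    using that by (auto simp: matching_of_def card_insert_if)
  moreover have "\<Union> (matching_of m E) = {1..m}"
    using arc_set_subset[OF assms] by (fastforce simp: matching_of_def)
  moreover have "disjoint (matching_of m E)"
  proof (rule disjointI, rule ccontr)
    fix A B assume "A \<in> matching_of m E" "B \<in> matching_of m E" and neq: "A \<noteq> B" and "A \<inter> B \<noteq> {}"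
    then obtain v where v: "v \<in> A" "v \<in> B"
      by blast
    have block: "C = {v} \<and> v \<notin> fst ` E \<and> v \<notin> snd ` E \<or> (\<exists>i j. (i, j) \<in> E \<and> C = {i, j} \<and> v \<in> {i, j})"
      if "C \<in> matching_of m E" "v \<in> C" for C
      using that unfolding mem_matching_of by blast
    \<comment> \<open>The second case covers both mixed situations: \<open>v\<close> would be
      isolated and on an arc at once.\<close>
    consider "A = {v}" "B = {v}" | i j where "v \<notin> fst ` E" "v \<notin> snd ` E" "(i, j) \<in> E" "v \<in> {i, j}"
      | i j i' j' where "(i, j) \<in> E" "(i', j') \<in> E" "A = {i, j}" "B = {i', j'}" "v \<in> {i, j}" "v \<in> {i', j'}"
      using block[OF \<open>A \<in> matching_of m E\<close> v(1)] block[OF \<open>B \<in> matching_of m E\<close> v(2)] by blast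
    then show False
    proof cases
      case (3 i j i' j')
      then have "i \<noteq> j'" "i' \<noteq> j" "i = i' \<longleftrightarrow> j = j'"
        using assms unfolding arc_set_def by blast+
      then show ?thesis
        using 3 neq by auto
    qed (use neq in force)+
  qed
  moreover have "{} \<notin> matching_of m E"
    by (auto simp: matching_of_def)
  ultimately show ?thesis
    by (simp add: partial_matching_def partition_on_def)
qed

lemma arcs_matching_of:
  assumes "arc_set m E"
  shows "arcs (matching_of m E) = E"
  using assms by (force simp: arcs_def matching_of_def arc_set_def doubleton_eq_iff)

text \<open>Distinct openers have distinct closers, so for consecutive openers the failure of
  \<open>j < j'\<close> is precisely a nesting.\<close>

lemma avoiding_iff:
  assumes "arc_set m E"
  shows "avoiding E \<longleftrightarrow> \<not> (\<exists>a\<in>E. \<exists>b\<in>E. neighbor_alignment a b) \<and>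
    \<not> (\<exists>a\<in>E. \<exists>b\<in>E. left_nesting a b)"
proof -
  have "neighbor_alignment (i, j) (i', j') \<longleftrightarrow> i' = Suc j"
    "left_nesting (i, j) (i', j') \<longleftrightarrow> i' = Suc i \<and> \<not> j < j'"
    if "(i, j) \<in> E" "(i', j') \<in> E" for i j i' j'
  proof -
    have "i < j" "i' < j'" "i = i' \<longleftrightarrow> j = j'"
      using assms that unfolding arc_set_def by blast+
    then show "neighbor_alignment (i, j) (i', j') \<longleftrightarrow> i' = Suc j"
      "left_nesting (i, j) (i', j') \<longleftrightarrow> i' = Suc i \<and> \<not> j < j'"
      by (auto simp: neighbor_alignment_def left_nesting_def)
  qed
  then show ?thesis
    unfolding avoiding_def Bex_def split_paired_Ex by metis
qed

lemma Q_eq_card_avoiding_arc_sets: "Q m k = card (avoiding_arc_sets m k)"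
  unfolding Q_def
proof (rule bij_betw_same_card, rule bij_betw_byWitness[where f = arcs and f' = "matching_of m"])
qed (auto simp: avoiding_arc_sets_def matching_of_arcs arcs_matching_of arc_set_arcs
    partial_matching_matching_of avoiding_iff[of m])

lemma Q_rec: "Q (m + 2) (Suc k) = Q (Suc m) (Suc k) + (m + 1 - 2 * k) * Q m k"
  by (simp only: Q_eq_card_avoiding_arc_sets card_avoiding_arc_sets_rec)

lemma Q_0: "Q m 0 = 1"
  by (simp add: Q_eq_card_avoiding_arc_sets avoiding_arc_sets_0)

lemma Q_eq_0: "m < 2 * k \<Longrightarrow> Q m k = 0"
  by (simp add: Q_eq_card_avoiding_arc_sets avoiding_arc_sets_empty)

section \<open>Coefficients of the summands on the right-hand side\<close>

unbundle fps_syntax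

definition denom :: "nat \<Rightarrow> rat fps fps" where
  "denom n = (\<Prod>k=1..n. 1 - of_nat k * X\<^sup>2 * Y)"

text \<open>The coefficient of \<open>X^(n + 2k) Y^k\<close> is the Stirling number of the second
  kind S(n + k, n).\<close>

definition row_gf :: "nat \<Rightarrow> rat fps fps" where
  "row_gf n = X ^ n / denom n"

lemma denom_nth_0: "denom n $ 0 = 1"
  unfolding denom_def
  by (induction n) (simp_all add: power2_eq_square)

lemma row_gf_mult_denom: "row_gf n * denom n = X ^ n"
proof -
  have "subdegree (denom n) = 0"
    using denom_nth_0[of n] by (simp add: subdegree_eq_0_iff)
  then have "row_gf n = X ^ n * inverse (denom n)"
    unfolding row_gf_def by (rule fps_divide_unit')
  \<comment> \<open>The coefficient ring \<open>rat fps\<close> is not a field; invertibility comes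
    from the constant coefficient being 1.\<close>
  moreover have "denom n * inverse (denom n) = 1"
    unfolding fps_inverse_def by (rule fps_right_inverse) (simp add: denom_nth_0 fps_inverse_def fps_lr_inverse_one_one)
  ultimately show ?thesis
    by (simp add: mult.assoc mult.commute[of _ "denom n"])
qed

text \<open>Clearing only the last factor of \<open>denom (Suc n)\<close> leaves
  \<open>X * row_gf n\<close>; the common factor \<open>denom n\<close> is nonzero and
  cancels.\<close>

lemma row_gf_Suc: "row_gf (Suc n) = X * row_gf n + of_nat (Suc n) * X\<^sup>2 * Y * row_gf (Suc n)"
proof -
  let ?r = "1 - of_nat (Suc n) * X\<^sup>2 * Y"
  have "denom (Suc n) = denom n * ?r"
    by (simp add: denom_def)
  then have "row_gf (Suc n) * ?r * denom n = X * row_gf n * denom n"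
    using row_gf_mult_denom[of n] row_gf_mult_denom[of "Suc n"]
    by (simp add: mult_ac del: of_nat_Suc)
  moreover have "denom n \<noteq> 0"
    using denom_nth_0[of n] by auto
  ultimately have "row_gf (Suc n) * ?r = X * row_gf n"
    by simp
  then show ?thesis
    by (simp add: algebra_simps del: of_nat_Suc)
qed

text \<open>Multiplication by \<open>X\<^sup>2 * Y\<close> shifts the degrees by two and one, so
  \<open>Suc N\<close> becomes \<open>N - 1\<close>; the conditional guards both natural
  subtractions.\<close>

lemma row_gf_Suc_nth:
  "row_gf (Suc n) $ Suc N $ k =
     row_gf n $ N $ k + (if N = 0 \<or> k = 0 then 0 else of_nat (Suc n) * row_gf (Suc n) $ (N - 1) $ (k - 1))"
proof -
  have "of_nat (Suc n) * X\<^sup>2 * Y * row_gf (Suc n) = (of_nat (Suc n) * Y) * (X\<^sup>2 * row_gf (Suc n))"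
    by (simp only: mult_ac)
  also have "of_nat (Suc n) * Y = fps_const (fps_const (of_nat (Suc n)) * fps_X)"
    by (simp only: fps_const_mult[symmetric] fps_of_nat)
  finally have eq: "of_nat (Suc n) * X\<^sup>2 * Y * row_gf (Suc n) =
      fps_const (fps_const (of_nat (Suc n)) * fps_X) * (X\<^sup>2 * row_gf (Suc n))" .
  have "row_gf (Suc n) $ Suc N =
      (X * row_gf n + fps_const (fps_const (of_nat (Suc n)) * fps_X) * (X\<^sup>2 * row_gf (Suc n))) $ Suc N"
    using row_gf_Suc[of n] unfolding eq by (rule arg_cong)
  also have "\<dots> = row_gf n $ N +
      (if N = 0 then 0 else fps_const (of_nat (Suc n)) * (fps_X * row_gf (Suc n) $ (N - 1)))"
    unfolding fps_add_nth fps_mult_left_const_nth fps_X_power_mult_nth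
    by (simp add: mult.assoc del: of_nat_Suc fps_const_mult)
  finally show ?thesis
    by (simp del: of_nat_Suc)
qed

lemma row_gf_0: "row_gf 0 = 1"
  using row_gf_mult_denom[of 0] by (simp add: denom_def)

lemma row_gf_Suc_nth_0: "row_gf (Suc n) $ 0 = 0"
  by (subst row_gf_Suc) (simp add: power2_eq_square)

text \<open>Strong induction on \<open>N\<close>, because the coefficient recurrence reaches two
  degrees back, just as \<open>Q_rec\<close> does.\<close>

lemma row_gf_nth:
  "row_gf (Suc n) $ Suc N $ k = (if N = n + 2 * k then of_nat (Q N k) else 0)"
proof (induction N arbitrary: n k rule: less_induct)
  case (less N)
  show ?case
  proof (cases N)
    case 0
    then show ?thesis
      by (cases n) (auto simp: row_gf_Suc_nth row_gf_0 row_gf_Suc_nth_0 Q_0)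
  next
    case N: (Suc N')
    \<comment> \<open>For \<open>n = 0\<close> the series is 1, which vanishes in the positive
      degree \<open>N\<close>.\<close>
    have 1: "row_gf n $ N $ k = (if n > 0 \<and> N = n + 2 * k then of_nat (Q N' k) else 0)"
      using less.IH[of N'] N by (cases n) (auto simp: row_gf_0)
    show ?thesis
    proof (cases k)
      case 0
      then show ?thesis
        using 1 N by (simp add: row_gf_Suc_nth Q_0)
    next
      case k: (Suc k')
      show ?thesis
      proof (cases N')
        case 0
        then show ?thesis
          using 1 N k by (simp add: row_gf_Suc_nth row_gf_Suc_nth_0)
      next
        case M: (Suc M)
        have "row_gf (Suc n) $ Suc M $ k' = (if M = n + 2 * k' then of_nat (Q M k') else 0)"
          using less.IH[of M] M N by simp
        then have "row_gf (Suc n) $ Suc N $ k = (if N = n + 2 * k then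
            of_nat ((if n > 0 then Q N' k else 0) + Suc n * Q M k') else 0)"
          using 1 N M k by (subst row_gf_Suc_nth) (simp add: distrib_right)
        \<comment> \<open>Here \<open>M + 1 - 2 * k' = Suc n\<close>, so the factor from the
          denominator is the number of insertion points. For \<open>n = 0\<close> the absent term is
          zero anyway, since \<open>N' < 2 * k\<close>.\<close>
        moreover have "(if n > 0 then Q N' k else 0) + Suc n * Q M k' = Q N k" if "N = n + 2 * k"
          using Q_rec[of M k'] Q_eq_0[of N' k] that N M k by auto
        ultimately show ?thesis
          by simp
      qed
    qed
  qed
qed

section \<open>Convergence and comparison of the two series\<close>

text \<open>Only the summands with \<open>n \<le> N\<close> reach degree \<open>N\<close>, so each
  coefficient of the partial sums is eventually constant.\<close>

lemma fps_sums_if_nth_eq_0: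
  fixes f :: "nat \<Rightarrow> 'a::ab_group_add fps"
  assumes "\<And>n N. N < n \<Longrightarrow> f n $ N = 0"
  shows "f sums Abs_fps (\<lambda>N. \<Sum>n\<le>N. f n $ N)"
  unfolding sums_def
proof (rule tendsto_fpsI)
  fix N
  have "(\<Sum>i<n. f i) $ N = (\<Sum>i\<le>N. f i $ N)" if "n > N" for n
    unfolding fps_sum_nth using that assms by (intro sum.mono_neutral_right) auto
  with eventually_gt_at_top[of N]
  show "\<forall>\<^sub>F n in sequentially. (\<Sum>i<n. f i) $ N = Abs_fps (\<lambda>N. \<Sum>n\<le>N. f n $ N) $ N"
    unfolding fps_nth_Abs_fps by (rule eventually_mono)
qed

theorem theorem1p2:
  defines "L \<equiv> (\<lambda>n. \<Sum>k=0..(n - 1) div 2. of_nat (Q (n - 1) k) * X ^ n * Y ^ k)"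
      and "R \<equiv> (\<lambda>n. X ^ n / (\<Prod>k=1..n. 1 - of_nat k * X\<^sup>2 * Y))"
  shows "summable (\<lambda>n. L (Suc n)) \<and> summable (\<lambda>n. R (Suc n)) \<and>
         (\<Sum>n. L (Suc n)) = (\<Sum>n. R (Suc n))"
proof -
  have R: "R = row_gf"
    by (simp add: R_def row_gf_def denom_def fun_eq_iff)
  have monomial: "of_nat q * X ^ n * Y ^ k = fps_const (fps_const (of_nat q) * fps_X ^ k) * X ^ n"
    for q n k
    by (simp only: fps_const_mult[symmetric] fps_const_power[symmetric] fps_of_nat mult_ac)
  have L: "L (Suc n) $ N $ k = (if N = Suc n then of_nat (Q n k) else 0)" for n N k
  proof -
    have "L (Suc n) $ N $ k =
        (\<Sum>j = 0..n div 2. if N = Suc n \<and> k = j then of_nat (Q n j) else 0)"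
      unfolding L_def monomial fps_sum_nth by (intro sum.cong) auto
    also have "\<dots> = (if N = Suc n \<and> k \<le> n div 2 then of_nat (Q n k) else 0)"
      by (cases "N = Suc n") simp_all
    \<comment> \<open>Beyond \<open>n div 2\<close> arcs \<open>Q\<close> vanishes, so the bound on
      \<open>k\<close> drops out.\<close>
    finally show ?thesis
      using Q_eq_0[of n k] by auto
  qed
  have L_0: "L (Suc n) $ N = 0" if "N < n" for n N
    using L that by (intro fps_ext) simp
  have R_0: "R (Suc n) $ N = 0" if "N < n" for n N
    using row_gf_nth that by (cases N; intro fps_ext) (simp_all add: R row_gf_Suc_nth_0)
  \<comment> \<open>For \<open>N = Suc M\<close> both sums reduce to \<open>Q M k\<close>: on the
    left from \<open>n = M\<close>, on the right from \<open>n = M - 2 * k\<close>.\<close>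
  have "(\<Sum>n\<le>N. L (Suc n) $ N) = (\<Sum>n\<le>N. R (Suc n) $ N)" for N
  proof (rule fps_ext)
    fix k
    show "(\<Sum>n\<le>N. L (Suc n) $ N) $ k = (\<Sum>n\<le>N. R (Suc n) $ N) $ k"
    proof (cases N)
      case 0
      then show ?thesis
        by (simp add: L R row_gf_Suc_nth_0)
    next
      case N: (Suc M)
      have "(\<Sum>n\<le>N. R (Suc n) $ N) $ k = (\<Sum>n\<le>N. if M = n + 2 * k then of_nat (Q M k) else 0)"
        unfolding fps_sum_nth R N row_gf_nth ..
      \<comment> \<open>When the subtraction truncates, \<open>Q M k\<close> is zero, so both
        conditionals agree.\<close>
      also have "\<dots> = (\<Sum>n\<le>N. if n = M - 2 * k then of_nat (Q M k) else 0)"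
        using Q_eq_0[of M k] by (intro sum.cong) auto
      also have "\<dots> = of_nat (Q M k)"
        using N by simp
      also have "\<dots> = (\<Sum>n\<le>N. L (Suc n) $ N) $ k"
        using N by (simp add: fps_sum_nth L)
      finally show ?thesis ..
    qed
  qed
  \<comment> \<open>Both series are given the same explicit limit, written with the coefficients of
    \<open>L\<close>.\<close>
  then have "(\<lambda>n. R (Suc n)) sums Abs_fps (\<lambda>N. \<Sum>n\<le>N. L (Suc n) $ N)"
    using fps_sums_if_nth_eq_0[of "\<lambda>n. R (Suc n)"] R_0 by simp
  moreover have "(\<lambda>n. L (Suc n)) sums Abs_fps (\<lambda>N. \<Sum>n\<le>N. L (Suc n) $ N)"
    using fps_sums_if_nth_eq_0[of "\<lambda>n. L (Suc n)"] L_0 by simp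
  ultimately show ?thesis
    by (auto simp: sums_iff)
qed

end
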